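(* Let $E$ be a $T$-universally complete Riesz space with weak order unit $e=Te$, where $T$ is a strictly positive conditional expectation operator on $E$. Let $(P_j)_{j\in\mathbb{N}}$ be $T$-conditionally independent band projections on $E$ with $TP_je=f$ for all $j\in\mathbb{N}$ (for some fixed $f\in E$), and let $S_n=\sum_{j=1}^nP_je$ for $n\in\mathbb{N}$. Then, for all $n\in\mathbb{N}$ and $j\in\{0,1,\dots,n\}$, $$TS_n=nf,$$ $$TP_{S_n=je}e=\frac{n!}{j!(n-j)!}f^j(e-f)^{n-j},$$ $$\mathrm{var}(S_n)=nf(e-f).$$
   Context: A conditional expectation operator on a Dedekind complete Riesz space $E$ with weak order unit is a positive order continuous projection $T:E\to E$ whose range $\mathcal{R}(T)$ is a Dedekind complete Riesz subspace of $E$ and such that $Te$ is a weak order unit of $E$ for each weak order unit $e$ of $E$. $T$ is strictly positive if $f\ge 0$ and $Tf=0$ imply $f=0$. Given a strictly positive conditional expectation operator $T$ on a Dedekind complete Riesz space $E$ with weak order unit, $E$ is called $T$-universally complete if each increasing net $(f_\alpha)$ in $E_+$ for which $(Tf_\alpha)$ is order bounded in the universal completion $E^u$ of $E$ is order convergent in $E$. (A $T$-universally complete space is in particular Dedekind complete.) The universal completion $E^u$ carries its natural $f$-algebra multiplication with multiplicative unit $e$, determined by $(Pe)\cdot(Qe)=PQe$ for band projections $P,Q$. All products and powers are taken in $E^u$, with $h^0=e$. For $E$ $T$-universally complete, $\mathcal{L}^1(T)=E$ and $\mathcal{L}^2(T):=\{x\in\mathcal{L}^1(T) : x^2\in\mathcal{L}^1(T)\}$.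 $\mathcal{L}^2(T)$ is a vector space and is invariant under $T$. For $h\in\mathcal{L}^2(T)$ the variance is $\mathrm{var}(h):=T\big((h-Th)^2\big)=T(h^2)-(Th)^2$. For $h\in E_+$, $P_h$ denotes the band projection of $E$ onto the band generated by $h$; $P_{S_n=je}:=(I-P_{(S_n-je)^+})(I-P_{(S_n-je)^-})$ is the band projection onto the band where $S_n=je$ ($I$ is the identity map). $T$-conditional independence: Band projections $P,Q$ on $E$ are $T$-conditionally independent if $TPTQe=TPQe=TQTPe$. Riesz subspaces $E_1,E_2$ of $E$ are $T$-conditionally independent if all band projections $P_1,P_2$ in $E$ with $P_1e\in E_1$, $P_2e\in E_2$ are $T$-conditionally independent. For $A\subset E$, $\langle A\rangle$ denotes the order closed Riesz subspace of $E$ generated by $A$. A family $(E_\lambda)_{\lambda\in\Lambda}$ of closed Dedekind complete Riesz subspaces of $E$, each containing $\mathcal{R}(T)$, is $T$-conditionally independent if for each pair of disjoint sets $\Lambda_1,\Lambda_2\subset\Lambda$ the subspaces $\left\langle\bigcup_{\lambda\in\Lambda_1}E_\lambda\right\rangle$ and $\left\langle\bigcup_{\lambda\in\Lambda_2}E_\lambda\right\rangle$ are $T$-conditionally independent. A sequence $(P_k)$ of band projections is $T$-conditionally independent if the family $\langle\{P_ke\}\cup\mathcal{R}(T)\rangle$, $k\in\mathbb{N}$, is $T$-conditionally independent. *)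

theory Defs
  imports Complex_Main "HOL-Library.Lattice_Algebras"
begin

class riesz_space = lattice_ab_group_add_abs + ordered_real_vector

class dedekind_complete_riesz_space = riesz_space + conditionally_complete_lattice


subsection \<open>Nets and order convergence\<close>

definition directed_index :: "'i set \<Rightarrow> ('i \<Rightarrow> 'i \<Rightarrow> bool) \<Rightarrow> bool" where
  "directed_index I le \<longleftrightarrow> I \<noteq> {} \<and> reflp_on I le \<and> transp_on I le \<and>
     (\<forall>i\<in>I. \<forall>j\<in>I. \<exists>k\<in>I. le i k \<and> le j k)"

text \<open>
  The last condition bounds \<open>p\<close> below by \<open>0\<close>, so \<open>INF\<close> is a genuine infimum.
\<close>
definition order_converges ::
    "'i set \<Rightarrow> ('i \<Rightarrow> 'i \<Rightarrow> bool) \<Rightarrow> ('i \<Rightarrow> 'a::dedekind_complete_riesz_space) \<Rightarrow> 'a \<Rightarrow> bool" where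
  "order_converges I le f x \<longleftrightarrow> directed_index I le \<and>
     (\<exists>p. (\<forall>i\<in>I. \<forall>j\<in>I. le i j \<longrightarrow> p j \<le> p i) \<and> (INF i\<in>I. p i) = 0 \<and>
          (\<forall>i\<in>I. \<bar>f i - x\<bar> \<le> p i))"

text \<open>
  HOL cannot quantify over index types inside a formula. Below, nets in the space \<open>'a\<close> are
  indexed by directed subsets of \<open>'a\<close> (with an arbitrary preorder). This is no restriction:
  order continuity of positive operators, order closedness of Riesz subspaces and convergence of
  increasing nets are all determined by monotone nets, for which only the range matters, and
  the range is itself a directed set indexed by its own elements.
\<close>
definition order_continuous ::
    "('a::dedekind_complete_riesz_space \<Rightarrow> 'a) \<Rightarrow> bool" where
  "order_continuous T \<longleftrightarrow>
     (\<forall>(I::'a set) le f x. order_converges I le f x \<longrightarrow> order_converges I le (\<lambda>i. T (f i)) (T x))"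

definition order_closed :: "'a::dedekind_complete_riesz_space set \<Rightarrow> bool" where
  "order_closed F \<longleftrightarrow>
     (\<forall>(I::'a set) le f x. (\<forall>i\<in>I. f i \<in> F) \<and> order_converges I le f x \<longrightarrow> x \<in> F)"


subsection \<open>Riesz subspaces, bands and band projections\<close>

definition riesz_subspace :: "'a::riesz_space set \<Rightarrow> bool" where
  "riesz_subspace F \<longleftrightarrow> subspace F \<and> (\<forall>x\<in>F. \<forall>y\<in>F. sup x y \<in> F \<and> inf x y \<in> F)"

text \<open>Suprema are taken in the ordered set \<open>F\<close>, not in the ambient space.\<close>
definition dedekind_complete_on :: "'a::riesz_space set \<Rightarrow> bool" where
  "dedekind_complete_on F \<longleftrightarrow>
     (\<forall>D\<subseteq>F. D \<noteq> {} \<and> (\<exists>b\<in>F. \<forall>d\<in>D. d \<le> b) \<longrightarrow>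
        (\<exists>s\<in>F. (\<forall>d\<in>D. d \<le> s) \<and> (\<forall>b\<in>F. (\<forall>d\<in>D. d \<le> b) \<longrightarrow> s \<le> b)))"

definition closed_riesz_subspace_generated ::
    "'a::dedekind_complete_riesz_space set \<Rightarrow> 'a set" where
  "closed_riesz_subspace_generated A = (\<lambda>F. riesz_subspace F \<and> order_closed F) hull A"

definition riesz_ideal :: "'a::riesz_space set \<Rightarrow> bool" where
  "riesz_ideal A \<longleftrightarrow> subspace A \<and> (\<forall>x y. y \<in> A \<and> \<bar>x\<bar> \<le> \<bar>y\<bar> \<longrightarrow> x \<in> A)"

definition band :: "'a::dedekind_complete_riesz_space set \<Rightarrow> bool" where
  "band B \<longleftrightarrow> riesz_ideal B \<and> (\<forall>D\<subseteq>B. D \<noteq> {} \<and> bdd_above D \<longrightarrow> Sup D \<in> B)"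

definition disjoint_complement :: "'a::riesz_space set \<Rightarrow> 'a set" where
  "disjoint_complement A = {x. \<forall>y\<in>A. inf \<bar>x\<bar> \<bar>y\<bar> = 0}"

definition band_projection_onto ::
    "'a::dedekind_complete_riesz_space set \<Rightarrow> ('a \<Rightarrow> 'a) \<Rightarrow> bool" where
  "band_projection_onto B P \<longleftrightarrow>
     band B \<and> (\<forall>x. P x \<in> B \<and> x - P x \<in> disjoint_complement B)"

definition band_projection :: "('a::dedekind_complete_riesz_space \<Rightarrow> 'a) \<Rightarrow> bool" where
  "band_projection P \<longleftrightarrow> (\<exists>B. band_projection_onto B P)"

text \<open>
  The operator \<open>P\<^sub>h\<close>. In a Dedekind complete Riesz space every band is a projection band,
  so the description is well defined.
\<close>
definition proj_band_gen :: "'a::dedekind_complete_riesz_space \<Rightarrow> 'a \<Rightarrow> 'a" where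
  "proj_band_gen h = (THE P. band_projection_onto (band hull {h}) P)"

text \<open>
  The operator \<open>P\<^bsub>s=t\<^esub> = (I - P\<^bsub>(s-t)\<^sup>+\<^esub>)(I - P\<^bsub>(s-t)\<^sup>-\<^esub>)\<close>. The negative part of \<open>x\<close> is written
  \<open>pprt (- x)\<close>, because the library's \<open>nprt x = inf x 0\<close> has the opposite sign.
\<close>
definition proj_eq ::
    "'a::dedekind_complete_riesz_space \<Rightarrow> 'a \<Rightarrow> 'a \<Rightarrow> 'a" where
  "proj_eq s t = (\<lambda>x. x - proj_band_gen (pprt (s - t)) x) \<circ>
                 (\<lambda>x. x - proj_band_gen (pprt (- (s - t))) x)"

definition weak_order_unit :: "'a::dedekind_complete_riesz_space \<Rightarrow> bool" where
  "weak_order_unit e \<longleftrightarrow> 0 \<le> e \<and> band hull {e} = UNIV"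


subsection \<open>Universal completion and its multiplication\<close>

text \<open>
  Lateral completeness: in a Dedekind complete space a nonempty set has a supremum iff it is
  bounded above.
\<close>
definition laterally_complete :: "'u::dedekind_complete_riesz_space itself \<Rightarrow> bool" where
  "laterally_complete _ \<longleftrightarrow>
     (\<forall>D::'u set. (\<forall>x\<in>D. 0 \<le> x) \<and> pairwise (\<lambda>x y. inf x y = 0) D \<longrightarrow> bdd_above D)"

text \<open>
  The type \<open>'u\<close> is a universally complete (Dedekind and laterally complete) Riesz space, in
  which \<open>J\<close> embeds \<open>'a\<close> as an order dense Riesz subspace. The universal completion is unique up
  to a Riesz isomorphism fixing \<open>'a\<close>.
\<close>
definition universal_completion ::
    "('a::dedekind_complete_riesz_space \<Rightarrow> 'u::dedekind_complete_riesz_space) \<Rightarrow> bool" where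
  "universal_completion J \<longleftrightarrow>
     laterally_complete TYPE('u) \<and>
     linear J \<and> inj J \<and>
     (\<forall>x y. J (sup x y) = sup (J x) (J y)) \<and> (\<forall>x y. J (inf x y) = inf (J x) (J y)) \<and>
     (\<forall>u>0. \<exists>x>0. J x \<le> u)"

definition f_algebra_mult :: "('u::riesz_space \<Rightarrow> 'u \<Rightarrow> 'u) \<Rightarrow> bool" where
  "f_algebra_mult mul \<longleftrightarrow>
     (\<forall>x. linear (mul x)) \<and> (\<forall>y. linear (\<lambda>x. mul x y)) \<and>
     (\<forall>x y z. mul (mul x y) z = mul x (mul y z)) \<and>
     (\<forall>x y. 0 \<le> x \<and> 0 \<le> y \<longrightarrow> 0 \<le> mul x y) \<and>
     (\<forall>x y z. inf x y = 0 \<and> 0 \<le> z \<longrightarrow> inf (mul z x) y = 0 \<and> inf (mul x z) y = 0)"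

definition natural_f_algebra_mult ::
    "'u::dedekind_complete_riesz_space \<Rightarrow> ('u \<Rightarrow> 'u \<Rightarrow> 'u) \<Rightarrow> bool" where
  "natural_f_algebra_mult e mul \<longleftrightarrow>
     f_algebra_mult mul \<and>
     (\<forall>x. mul e x = x \<and> mul x e = x) \<and>
     (\<forall>P Q. band_projection P \<and> band_projection Q \<longrightarrow> mul (P e) (Q e) = P (Q e))"

definition mult_power :: "'u \<Rightarrow> ('u \<Rightarrow> 'u \<Rightarrow> 'u) \<Rightarrow> 'u \<Rightarrow> nat \<Rightarrow> 'u" where
  "mult_power e mul h n = (mul h ^^ n) e"


subsection \<open>Conditional expectation operators\<close>

definition cond_expectation :: "('a::dedekind_complete_riesz_space \<Rightarrow> 'a) \<Rightarrow> bool" where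
  "cond_expectation T \<longleftrightarrow>
     linear T \<and> (\<forall>x\<ge>0. 0 \<le> T x) \<and> order_continuous T \<and> T \<circ> T = T \<and>
     riesz_subspace (range T) \<and> dedekind_complete_on (range T) \<and>
     (\<forall>e. weak_order_unit e \<longrightarrow> weak_order_unit (T e))"

definition strictly_positive :: "('a::riesz_space \<Rightarrow> 'a) \<Rightarrow> bool" where
  "strictly_positive T \<longleftrightarrow> (\<forall>f\<ge>0. T f = 0 \<longrightarrow> f = 0)"

definition T_universally_complete ::
    "('a::dedekind_complete_riesz_space \<Rightarrow> 'u::dedekind_complete_riesz_space) \<Rightarrow>
     ('a \<Rightarrow> 'a) \<Rightarrow> bool" where
  "T_universally_complete J T \<longleftrightarrow>
     (\<forall>(I::'a set) le f.
        directed_index I le \<and> (\<forall>i\<in>I. \<forall>j\<in>I. le i j \<longrightarrow> f i \<le> f j) \<and> (\<forall>i\<in>I. 0 \<le> f i) \<and>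
        (\<exists>a b. \<forall>i\<in>I. J (T (f i)) \<in> {a..b}) \<longrightarrow>
        (\<exists>x. order_converges I le f x))"

text \<open>
  For \<open>T\<close>-universally complete spaces \<open>\<L>\<^sup>1(T)\<close> is the whole space \<open>'a\<close>; the square of \<open>x\<close> is
  formed in \<open>'u\<close> and has to lie in (the copy of) \<open>'a\<close>.
\<close>
definition L2 :: "('a \<Rightarrow> 'u) \<Rightarrow> ('u \<Rightarrow> 'u \<Rightarrow> 'u) \<Rightarrow> 'a set" where
  "L2 J mul = {x. mul (J x) (J x) \<in> range J}"

text \<open>Meaningful for \<open>h \<in> L2 J mul\<close>; then the square of \<open>h - T h\<close> lies in the range of \<open>J\<close>.\<close>
definition variance ::
    "('a::riesz_space \<Rightarrow> 'u) \<Rightarrow> ('u \<Rightarrow> 'u \<Rightarrow> 'u) \<Rightarrow> ('a \<Rightarrow> 'a) \<Rightarrow> 'a \<Rightarrow> 'a" where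
  "variance J mul T h = T (inv J (mul (J (h - T h)) (J (h - T h))))"


subsection \<open>Conditional independence\<close>

definition indep_projections ::
    "('a \<Rightarrow> 'a) \<Rightarrow> 'a \<Rightarrow> ('a \<Rightarrow> 'a) \<Rightarrow> ('a \<Rightarrow> 'a) \<Rightarrow> bool" where
  "indep_projections T e P Q \<longleftrightarrow> T (P (T (Q e))) = T (P (Q e)) \<and> T (P (Q e)) = T (Q (T (P e)))"

definition indep_subspaces ::
    "('a::dedekind_complete_riesz_space \<Rightarrow> 'a) \<Rightarrow> 'a \<Rightarrow> 'a set \<Rightarrow> 'a set \<Rightarrow> bool" where
  "indep_subspaces T e E1 E2 \<longleftrightarrow>
     (\<forall>P Q. band_projection P \<and> band_projection Q \<and> P e \<in> E1 \<and> Q e \<in> E2 \<longrightarrow>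
        indep_projections T e P Q)"

definition indep_family ::
    "('a::dedekind_complete_riesz_space \<Rightarrow> 'a) \<Rightarrow> 'a \<Rightarrow> 'i set \<Rightarrow> ('i \<Rightarrow> 'a set) \<Rightarrow> bool" where
  "indep_family T e \<Lambda> F \<longleftrightarrow>
     (\<forall>l\<in>\<Lambda>. riesz_subspace (F l) \<and> order_closed (F l) \<and> dedekind_complete_on (F l) \<and>
            range T \<subseteq> F l) \<and>
     (\<forall>\<Lambda>1 \<Lambda>2. \<Lambda>1 \<subseteq> \<Lambda> \<and> \<Lambda>2 \<subseteq> \<Lambda> \<and> \<Lambda>1 \<inter> \<Lambda>2 = {} \<longrightarrow>
        indep_subspaces T e (closed_riesz_subspace_generated (\<Union>l\<in>\<Lambda>1. F l))
                            (closed_riesz_subspace_generated (\<Union>l\<in>\<Lambda>2. F l)))"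

text \<open>Sequences are indexed by the positive integers; \<open>P 0\<close> is irrelevant.\<close>
definition indep_projection_seq ::
    "('a::dedekind_complete_riesz_space \<Rightarrow> 'a) \<Rightarrow> 'a \<Rightarrow> (nat \<Rightarrow> 'a \<Rightarrow> 'a) \<Rightarrow> bool" where
  "indep_projection_seq T e P \<longleftrightarrow>
     (\<forall>k\<ge>1. band_projection (P k)) \<and>
     indep_family T e {1..} (\<lambda>k. closed_riesz_subspace_generated ({P k e} \<union> range T))"

end

theory Submission
  imports Defs
begin

text \<open>
  A band projection \<open>P\<close> plays the role of an event with indicator \<open>P e\<close>, and \<open>T\<close> that of a conditional
  expectation. The proof is that of the classical binomial distribution; what needs an argument is
  how products and level sets are handled without points.

  \<^emph>\<open>Products.\<close> Two facts connect \<open>T\<close> with the multiplication of the universal completion: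
  \<open>P x = (P e) x\<close>, and the averaging property \<open>T (P x) = T (P e) x\<close> for \<open>x\<close> in the range of \<open>T\<close>.
  In each of them both sides are operators in \<open>x\<close> that are dominated by \<open>\<bar>x\<bar>\<close> and agree at \<open>x = e\<close>.
  Two such operators agree on the whole interval between \<open>0\<close> and \<open>e\<close> (\<open>dominated_operators_agree\<close>):
  their difference \<open>D\<close> satisfies \<open>\<bar>D x\<bar> = \<bar>D (x - t e)\<bar> \<le> 2 \<bar>x - t e\<bar>\<close> for every real \<open>t\<close>, and the
  infimum of the right hand side over \<open>t\<close> is \<open>0\<close>.

  \<^emph>\<open>Level sets.\<close> The projections \<open>P 1, \<dots>, P n\<close> divide the space into the bands on which a given number
  of them occurs. The projections onto these bands and their unions are defined by recursion on \<open>n\<close>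
  (\<open>count_event\<close>). On the bands where more than \<open>j\<close> of them occur the element \<open>S - je\<close> is at least
  \<open>e\<close>, where fewer occur it is at most \<open>- e\<close>, and where exactly \<open>j\<close> occur it vanishes; this
  identifies \<open>count_event P n {j}\<close> with the projection onto the band where \<open>S = je\<close>
  (\<open>proj_eq_sum_eq_count_event\<close>).

  Conditioning on the last projection then gives the recursion
  \<open>p (n + 1) (j + 1) = f p n j + (e - f) p n (j + 1)\<close> for the conditional probabilities
  (\<open>T_count_event_Suc\<close>), and Pascal's rule solves it. For the variance, the centered indicators
  \<open>P i e - f\<close> have covariance \<open>0\<close> for distinct indices and \<open>f (e - f)\<close> otherwise
  (\<open>T_centered_product\<close>).
\<close>

section \<open>Order projections\<close>

text \<open>
  This is the description of band projections by \<open>0 \<le> Q \<le> I\<close> and \<open>Q\<^sup>2 = Q\<close>. It does not mention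
  the band, so that algebraic combinations of projections are projections by calculation.
\<close>
definition order_projection :: "('a::riesz_space \<Rightarrow> 'a) \<Rightarrow> bool" where
  "order_projection Q \<longleftrightarrow> linear Q \<and> (\<forall>x. Q (Q x) = Q x) \<and> (\<forall>x\<ge>0. 0 \<le> Q x \<and> Q x \<le> x)"

context
  fixes Q :: "'a::riesz_space \<Rightarrow> 'a"
  assumes Q: "order_projection Q"
begin

lemma order_projection_linear: "linear Q"
  using Q by (simp add: order_projection_def)

lemma order_projection_idem: "Q (Q x) = Q x"
  using Q by (simp add: order_projection_def)

lemma order_projection_nonneg: "0 \<le> x \<Longrightarrow> 0 \<le> Q x"
  using Q by (simp add: order_projection_def)

lemma order_projection_le: "0 \<le> x \<Longrightarrow> Q x \<le> x"
  using Q by (simp add: order_projection_def)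

lemmas order_projection_add = linear_add[OF order_projection_linear]
lemmas order_projection_diff = linear_diff[OF order_projection_linear]
lemmas order_projection_neg = linear_neg[OF order_projection_linear]
lemmas order_projection_scale = linear_scale[OF order_projection_linear]
lemmas order_projection_0 = linear_0[OF order_projection_linear]

lemma order_projection_mono: "x \<le> y \<Longrightarrow> Q x \<le> Q y"
  using order_projection_nonneg[of "y - x"] order_projection_diff by simp

lemma order_projection_compl_mono: "x \<le> y \<Longrightarrow> x - Q x \<le> y - Q y"
  using order_projection_le[of "y - x"] order_projection_diff by (simp add: algebra_simps)

lemma order_projection_fixes_below:
  assumes "0 \<le> z" "z \<le> y" "Q y = y"
  shows "Q z = z"
  using order_projection_compl_mono[OF assms(2)] order_projection_le[OF assms(1)] assms(3)
  by (simp add: antisym)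

lemma order_projection_kills_below:
  assumes "0 \<le> z" "z \<le> y" "Q y = 0"
  shows "Q z = 0"
  using order_projection_mono[OF assms(2)] order_projection_nonneg[OF assms(1)] assms(3)
  by (simp add: antisym)

lemma order_projection_abs_le: "\<bar>Q x\<bar> \<le> Q \<bar>x\<bar>"
proof (rule abs_leI)
  show "Q x \<le> Q \<bar>x\<bar>" by (rule order_projection_mono) (rule abs_ge_self)
  show "- Q x \<le> Q \<bar>x\<bar>"
    using order_projection_mono[of "- x" "\<bar>x\<bar>"] abs_ge_minus_self order_projection_neg by auto
qed

lemma order_projection_compl_abs_le: "\<bar>x - Q x\<bar> \<le> \<bar>x\<bar> - Q \<bar>x\<bar>"
proof (rule abs_leI)
  show "x - Q x \<le> \<bar>x\<bar> - Q \<bar>x\<bar>"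
    by (rule order_projection_compl_mono) (rule abs_ge_self)
  show "- (x - Q x) \<le> \<bar>x\<bar> - Q \<bar>x\<bar>"
    using order_projection_compl_mono[of "- x" "\<bar>x\<bar>"] abs_ge_minus_self order_projection_neg
    by auto
qed

lemma order_projection_abs: "Q \<bar>x\<bar> = \<bar>Q x\<bar>"
proof (rule antisym)
  have "\<bar>x\<bar> = \<bar>Q x + (x - Q x)\<bar>" by simp
  also have "\<dots> \<le> \<bar>Q x\<bar> + \<bar>x - Q x\<bar>" by (rule abs_triangle_ineq)
  also have "\<dots> \<le> \<bar>Q x\<bar> + (\<bar>x\<bar> - Q \<bar>x\<bar>)"
    by (rule add_left_mono[OF order_projection_compl_abs_le])
  finally show "Q \<bar>x\<bar> \<le> \<bar>Q x\<bar>" by (simp add: algebra_simps)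
qed (rule order_projection_abs_le)

text \<open>The meet of the two parts is fixed by \<open>Q\<close> and killed by \<open>Q\<close>.\<close>
lemma order_projection_disjoint: "inf \<bar>Q y\<bar> \<bar>x - Q x\<bar> = 0"
proof -
  let ?z = "inf \<bar>Q y\<bar> \<bar>x - Q x\<bar>"
  have z0: "0 \<le> ?z" by simp
  have "Q ?z = ?z"
    using z0
  proof (rule order_projection_fixes_below)
    show "?z \<le> Q \<bar>y\<bar>" using order_projection_abs_le by (meson inf.cobounded1 order_trans)
  qed (rule order_projection_idem)
  moreover have "Q ?z = 0"
    using z0
  proof (rule order_projection_kills_below)
    show "?z \<le> \<bar>x\<bar> - Q \<bar>x\<bar>"
      using order_projection_compl_abs_le by (meson inf.cobounded2 order_trans)
  qed (simp add: order_projection_diff order_projection_idem)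
  ultimately show ?thesis by simp
qed

end

lemma order_projection_comp_fixed:
  fixes P Q :: "'a::riesz_space \<Rightarrow> 'a"
  assumes P: "order_projection P" and Q: "order_projection Q"
  shows "P (Q (P x)) = Q (P x)"
proof -
  have pos: "P (Q (P x)) = Q (P x)" if "0 \<le> x" for x
  proof (rule order_projection_fixes_below[OF P])
    show "0 \<le> Q (P x)" "Q (P x) \<le> P x"
      using that by (simp_all add: order_projection_nonneg[OF Q] order_projection_nonneg[OF P]
          order_projection_le[OF Q])
  qed (rule order_projection_idem[OF P])
  have "P (Q (P x)) = P (Q (P (pprt x - pprt (- x))))"
    by (simp add: pprt_neg flip: prts)
  also have "\<dots> = Q (P (pprt x - pprt (- x)))"
    using pos[of "pprt x"] pos[of "pprt (- x)"]
    by (simp add: order_projection_diff[OF P] order_projection_diff[OF Q])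
  finally show ?thesis by (simp add: pprt_neg flip: prts)
qed

lemma order_projection_compl:
  assumes P: "order_projection P"
  shows "order_projection (\<lambda>x. x - P x)"
  unfolding order_projection_def
proof (intro conjI allI impI)
  show "linear (\<lambda>x. x - P x)"
    by (rule linear_compose_sub[OF linear_ident order_projection_linear[OF P]])
qed (simp_all add: order_projection_diff[OF P] order_projection_idem[OF P]
    order_projection_nonneg[OF P] order_projection_le[OF P])

text \<open>
  As \<open>0 \<le> Q \<le> I\<close>, the operator \<open>Q\<close> leaves the range of \<open>P\<close> invariant, and likewise the range of
  the complement of \<open>P\<close>.
\<close>
lemma order_projection_commute:
  fixes P Q :: "'a::riesz_space \<Rightarrow> 'a"
  assumes P: "order_projection P" and Q: "order_projection Q"
  shows "P (Q x) = Q (P x)"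
proof -
  have "P (Q x) = P (Q (P x)) + P (Q (x - P x))"
    by (simp add: order_projection_diff[OF P] order_projection_diff[OF Q])
  also have "P (Q (x - P x)) = 0"
    using order_projection_comp_fixed[OF order_projection_compl[OF P] Q, of x] by simp
  finally show ?thesis by (simp add: order_projection_comp_fixed[OF P Q])
qed

text \<open>Projections may be chosen separately on the two bands into which \<open>P\<close> splits the space.\<close>
lemma order_projection_splice:
  fixes P Q R :: "'a::riesz_space \<Rightarrow> 'a"
  assumes P: "order_projection P" and Q: "order_projection Q" and R: "order_projection R"
  shows "order_projection (\<lambda>x. P (Q x) + (R x - P (R x)))"
  unfolding order_projection_def
proof (intro conjI allI impI)
  note lin = linear_compose[OF order_projection_linear order_projection_linear, unfolded o_def]
  show "linear (\<lambda>x. P (Q x) + (R x - P (R x)))"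
    by (intro linear_compose_add linear_compose_sub lin order_projection_linear P Q R)
next
  fix x
  note C = order_projection_commute[OF Q P] order_projection_commute[OF R P]
    order_projection_idem[OF P] order_projection_idem[OF Q] order_projection_idem[OF R]
    order_projection_add[OF P] order_projection_add[OF Q] order_projection_add[OF R]
    order_projection_diff[OF P] order_projection_diff[OF Q] order_projection_diff[OF R]
  show "P (Q (P (Q x) + (R x - P (R x)))) +
      (R (P (Q x) + (R x - P (R x))) - P (R (P (Q x) + (R x - P (R x))))) =
      P (Q x) + (R x - P (R x))"
    by (simp add: C)
next
  fix x :: 'a assume x: "0 \<le> x"
  show "0 \<le> P (Q x) + (R x - P (R x))"
    using x by (intro add_nonneg_nonneg)
      (simp_all add: order_projection_nonneg[OF P] order_projection_nonneg[OF Q]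
        order_projection_nonneg[OF R] order_projection_le[OF P])
  have "P (Q x) + (R x - P (R x)) \<le> P x + (x - P x)"
    using x by (intro add_mono order_projection_mono[OF P] order_projection_compl_mono[OF P]
        order_projection_le[OF Q] order_projection_le[OF R])
  then show "P (Q x) + (R x - P (R x)) \<le> x" by simp
qed

text \<open>The intersection of two events is the meet of their indicators in the lattice.\<close>
lemma order_projection_comp_eq_inf:
  fixes P Q :: "'a::riesz_space \<Rightarrow> 'a"
  assumes P: "order_projection P" and Q: "order_projection Q" and e: "0 \<le> e"
  shows "P (Q e) = inf (P e) (Q e)"
proof (rule antisym)
  show "P (Q e) \<le> inf (P e) (Q e)"
    by (simp add: e order_projection_mono[OF P] order_projection_le[OF P]
        order_projection_le[OF Q] order_projection_nonneg[OF Q])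
  have "P (inf (P e) (Q e)) = inf (P e) (Q e)"
    by (rule order_projection_fixes_below[OF P, of _ "P e"])
      (simp_all add: e order_projection_nonneg[OF P] order_projection_nonneg[OF Q]
        order_projection_idem[OF P])
  moreover have "P (inf (P e) (Q e)) \<le> P (Q e)"
    by (rule order_projection_mono[OF P]) simp
  ultimately show "inf (P e) (Q e) \<le> P (Q e)" by simp
qed


section \<open>Band projections are order projections\<close>

lemma disjoint_add:
  fixes a b c :: "'a::riesz_space"
  assumes "0 \<le> a" "0 \<le> b" "0 \<le> c" "inf a c = 0" "inf b c = 0"
  shows "inf (a + b) c = 0"
proof -
  let ?z = "inf (a + b) c"
  have "?z - a \<le> b" by (simp add: diff_le_eq add.commute)
  moreover have "?z - a \<le> c" using assms(1) by (simp add: diff_le_eq le_infI2 add_increasing2)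
  ultimately have "?z \<le> a" using assms(5) le_inf_iff[of "?z - a" b c] by simp
  then have "?z \<le> inf a c" by simp
  then show ?thesis using assms by (simp add: antisym)
qed

lemma disjoint_scale:
  fixes a c :: "'a::riesz_space"
  assumes "0 \<le> a" "0 \<le> c" "inf a c = 0" "0 \<le> r"
  shows "inf (r *\<^sub>R a) c = 0"
proof -
  let ?z = "inf (r *\<^sub>R a) c"
  define s where "s = 1 + r"
  have s: "0 < s" "1 \<le> s" "r \<le> s" "inverse s \<le> 1"
    using assms(4) by (auto simp: s_def inverse_le_1_iff)
  have z0: "0 \<le> ?z" using assms by (simp add: scaleR_nonneg_nonneg)
  have "?z \<le> s *\<^sub>R a"
    by (rule order_trans[OF inf.cobounded1 scaleR_right_mono[OF s(3) assms(1)]])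
  then have "inverse s *\<^sub>R ?z \<le> inverse s *\<^sub>R (s *\<^sub>R a)"
    using s(1) by (intro scaleR_left_mono) auto
  then have "inverse s *\<^sub>R ?z \<le> a" using s(1) by simp
  moreover have "inverse s *\<^sub>R ?z \<le> 1 *\<^sub>R ?z" by (rule scaleR_right_mono[OF s(4) z0])
  then have "inverse s *\<^sub>R ?z \<le> c" by (metis inf.cobounded2 order_trans scaleR_one)
  ultimately have "inverse s *\<^sub>R ?z \<le> 0" unfolding assms(3)[symmetric] by (rule le_infI)
  then have "s *\<^sub>R (inverse s *\<^sub>R ?z) \<le> s *\<^sub>R 0"
    using s(1) by (intro scaleR_left_mono) auto
  then have "?z \<le> 0" using s(1) by simp
  then show ?thesis using z0 by (rule antisym)
qed

lemma disjoint_complement_add: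
  fixes x y :: "'a::riesz_space"
  assumes "x \<in> disjoint_complement B" "y \<in> disjoint_complement B"
  shows "x + y \<in> disjoint_complement B"
  unfolding disjoint_complement_def
proof (intro CollectI ballI)
  fix z assume "z \<in> B"
  then have "inf (\<bar>x\<bar> + \<bar>y\<bar>) \<bar>z\<bar> = 0"
    using assms by (intro disjoint_add) (auto simp: disjoint_complement_def)
  moreover have "inf \<bar>x + y\<bar> \<bar>z\<bar> \<le> inf (\<bar>x\<bar> + \<bar>y\<bar>) \<bar>z\<bar>"
    by (intro inf_mono abs_triangle_ineq order_refl)
  ultimately show "inf \<bar>x + y\<bar> \<bar>z\<bar> = 0" by (simp add: antisym)
qed

lemma abs_scale_le:
  fixes x :: "'a::riesz_space"
  shows "\<bar>r *\<^sub>R x\<bar> \<le> \<bar>r\<bar> *\<^sub>R \<bar>x\<bar>"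
proof (rule abs_leI)
  have bound: "r *\<^sub>R x \<le> \<bar>r\<bar> *\<^sub>R \<bar>x\<bar>" for r and x :: 'a
  proof (cases "0 \<le> r")
    case True
    then show ?thesis by (simp add: scaleR_left_mono abs_ge_self)
  next
    case False
    then have "(- r) *\<^sub>R (- x) \<le> (- r) *\<^sub>R \<bar>x\<bar>"
      by (intro scaleR_left_mono) (auto simp: abs_ge_minus_self)
    then show ?thesis using False by simp
  qed
  show "r *\<^sub>R x \<le> \<bar>r\<bar> *\<^sub>R \<bar>x\<bar>" by (rule bound)
  show "- (r *\<^sub>R x) \<le> \<bar>r\<bar> *\<^sub>R \<bar>x\<bar>" using bound[of "- r" x] by simp
qed

lemma disjoint_complement_scale:
  fixes x :: "'a::riesz_space"
  assumes "x \<in> disjoint_complement B"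
  shows "r *\<^sub>R x \<in> disjoint_complement B"
  unfolding disjoint_complement_def
proof (intro CollectI ballI)
  fix z assume "z \<in> B"
  then have "inf (\<bar>r\<bar> *\<^sub>R \<bar>x\<bar>) \<bar>z\<bar> = 0"
    using assms by (intro disjoint_scale) (auto simp: disjoint_complement_def)
  moreover have "inf \<bar>r *\<^sub>R x\<bar> \<bar>z\<bar> \<le> inf (\<bar>r\<bar> *\<^sub>R \<bar>x\<bar>) \<bar>z\<bar>"
    by (intro inf_mono abs_scale_le order_refl)
  ultimately show "inf \<bar>r *\<^sub>R x\<bar> \<bar>z\<bar> = 0" by (simp add: antisym)
qed

lemma band_subspace: "band B \<Longrightarrow> subspace B"
  by (simp add: band_def riesz_ideal_def)

lemma band_solid: "band B \<Longrightarrow> y \<in> B \<Longrightarrow> \<bar>x\<bar> \<le> \<bar>y\<bar> \<Longrightarrow> x \<in> B"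
  by (auto simp: band_def riesz_ideal_def)

text \<open>A band meets its disjoint complement only in \<open>0\<close>.\<close>
lemma band_projection_onto_unique:
  assumes BP: "band_projection_onto B P" and u: "u \<in> B" and v: "x - u \<in> disjoint_complement B"
  shows "P x = u"
proof -
  have B: "band B" "P x \<in> B" "x - P x \<in> disjoint_complement B"
    using BP by (auto simp: band_projection_onto_def)
  have "P x - u \<in> B" using band_subspace[OF B(1)] B(2) u by (rule subspace_diff)
  moreover have "P x - u \<in> disjoint_complement B"
    using disjoint_complement_add[OF v disjoint_complement_scale[OF B(3), of "- 1"]] by simp
  ultimately have "inf \<bar>P x - u\<bar> \<bar>P x - u\<bar> = 0" by (auto simp: disjoint_complement_def)
  then show ?thesis by simp
qed

lemma disjoint_sum_nonneg_imp_nonneg: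
  fixes u v :: "'a::riesz_space"
  assumes "inf \<bar>u\<bar> \<bar>v\<bar> = 0" "0 \<le> u + v"
  shows "0 \<le> u"
proof -
  have "- u \<le> v" using assms(2) diff_le_eq[of 0 u v] by (simp add: add.commute)
  then have "- u \<le> inf \<bar>u\<bar> \<bar>v\<bar>" by (meson abs_ge_minus_self abs_ge_self le_inf_iff order_trans)
  then have "- u \<le> 0" by (simp only: assms(1))
  then show ?thesis by simp
qed

lemma band_projection_imp_order_projection:
  assumes "band_projection P"
  shows "order_projection P"
proof -
  obtain B where BP: "band_projection_onto B P"
    using assms by (auto simp: band_projection_def)
  then have B: "band B" "\<And>x. P x \<in> B" "\<And>x. x - P x \<in> disjoint_complement B"
    by (auto simp: band_projection_onto_def)
  have S: "subspace B" using band_subspace[OF B(1)] .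
  have disj: "inf \<bar>P x\<bar> \<bar>x - P x\<bar> = 0" for x
    using B(3)[of x] B(2)[of x] unfolding disjoint_complement_def by (subst inf_commute) blast
  show ?thesis
    unfolding order_projection_def
  proof (intro conjI allI impI)
    show "linear P"
    proof (rule linearI)
      show "P (x + y) = P x + P y" for x y
      proof (rule band_projection_onto_unique[OF BP])
        show "P x + P y \<in> B" by (intro subspace_add S B)
        show "x + y - (P x + P y) \<in> disjoint_complement B"
          using disjoint_complement_add[OF B(3)[of x] B(3)[of y]] by (simp add: algebra_simps)
      qed
      show "P (r *\<^sub>R x) = r *\<^sub>R P x" for r x
      proof (rule band_projection_onto_unique[OF BP])
        show "r *\<^sub>R P x \<in> B" by (intro subspace_scale S B)
        show "r *\<^sub>R x - r *\<^sub>R P x \<in> disjoint_complement B"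
          using disjoint_complement_scale[OF B(3)[of x], of r] by (simp add: algebra_simps)
      qed
    qed
    show "P (P x) = P x" for x
      by (rule band_projection_onto_unique[OF BP B(2)])
        (simp add: disjoint_complement_def inf_absorb1)
    show "0 \<le> P x" if "0 \<le> x" for x
      by (rule disjoint_sum_nonneg_imp_nonneg[OF disj[of x]]) (simp add: that)
    have "0 \<le> x - P x" if "0 \<le> x" for x
      by (rule disjoint_sum_nonneg_imp_nonneg[of _ "P x"]) (simp_all add: that disj inf_commute)
    then show "P x \<le> x" if "0 \<le> x" for x using that by simp
  qed
qed

text \<open>
  If \<open>u\<close> bounds \<open>Q ` D\<close>, then \<open>u + (I - Q) (Sup D)\<close> bounds \<open>D\<close>, because \<open>I - Q\<close> is monotone as well.
\<close>
lemma order_projection_Sup: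
  fixes Q :: "'a::dedekind_complete_riesz_space \<Rightarrow> 'a"
  assumes Q: "order_projection Q" and D: "D \<noteq> {}" "bdd_above D"
  shows "Q (Sup D) = Sup (Q ` D)"
proof (rule antisym)
  have ub: "Q d \<le> Q (Sup D)" if "d \<in> D" for d
    by (intro order_projection_mono[OF Q] cSup_upper that D)
  then show "Sup (Q ` D) \<le> Q (Sup D)" using D by (intro cSup_least) auto
  have bdd: "bdd_above (Q ` D)" using ub by (auto intro: bdd_aboveI[of _ "Q (Sup D)"])
  have "d \<le> Sup (Q ` D) + (Sup D - Q (Sup D))" if "d \<in> D" for d
  proof -
    have "Q d + (d - Q d) \<le> Sup (Q ` D) + (Sup D - Q (Sup D))"
      using that D
      by (intro add_mono order_projection_compl_mono[OF Q] cSup_upper bdd) auto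
    then show ?thesis by simp
  qed
  then have "Sup D \<le> Sup (Q ` D) + (Sup D - Q (Sup D))"
    using D by (intro cSup_least) auto
  then have "0 \<le> Sup (Q ` D) - Q (Sup D)"
    using diff_right_mono[of "Sup D" _ "Sup D"] by (simp add: algebra_simps)
  then show "Q (Sup D) \<le> Sup (Q ` D)" by simp
qed

lemma order_projection_band_vimage:
  fixes Q :: "'a::dedekind_complete_riesz_space \<Rightarrow> 'a"
  assumes Q: "order_projection Q" and C: "band C"
  shows "band {x. Q x \<in> C}"
  unfolding band_def riesz_ideal_def
proof (intro conjI allI impI)
  note S = band_subspace[OF C]
  show "subspace {x. Q x \<in> C}"
    unfolding subspace_def
    by (auto simp: order_projection_0[OF Q] order_projection_add[OF Q] order_projection_scale[OF Q]
        intro: subspace_0 subspace_add subspace_scale S)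
  show "x \<in> {x. Q x \<in> C}" if "y \<in> {x. Q x \<in> C} \<and> \<bar>x\<bar> \<le> \<bar>y\<bar>" for x y
  proof -
    have "Q \<bar>x\<bar> \<le> Q \<bar>y\<bar>" using that by (intro order_projection_mono[OF Q]) simp
    then have "\<bar>Q x\<bar> \<le> \<bar>Q y\<bar>" by (simp only: order_projection_abs[OF Q])
    then show ?thesis using band_solid[OF C, of "Q y" "Q x"] that by simp
  qed
  show "Sup D \<in> {x. Q x \<in> C}" if D: "D \<subseteq> {x. Q x \<in> C}" "D \<noteq> {} \<and> bdd_above D" for D
  proof -
    have "bdd_above (Q ` D)"
      using D(2) order_projection_mono[OF Q] unfolding bdd_above_def by blast
    moreover have "Q ` D \<subseteq> C" using D(1) by auto
    ultimately have "Sup (Q ` D) \<in> C" using C D(2) unfolding band_def by simp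
    then show ?thesis using order_projection_Sup[OF Q] D by simp
  qed
qed

lemma band_zero: "band {0 :: 'a::dedekind_complete_riesz_space}"
  unfolding band_def riesz_ideal_def
proof (intro conjI allI impI)
  show "Sup D \<in> {0 :: 'a}" if "D \<subseteq> {0}" "D \<noteq> {} \<and> bdd_above D" for D
    using that by (metis cSup_singleton insert_not_empty singletonI subset_singletonD)
qed (auto simp: subspace_def)

lemma order_projection_band_range:
  fixes Q :: "'a::dedekind_complete_riesz_space \<Rightarrow> 'a"
  assumes Q: "order_projection Q"
  shows "band {x. Q x = x}"
proof -
  have "{x. Q x = x} = {x. x - Q x \<in> {0}}" by auto
  then show ?thesis
    using order_projection_band_vimage[OF order_projection_compl[OF Q] band_zero] by simp
qed

lemma order_projection_onto_range:
  fixes Q :: "'a::dedekind_complete_riesz_space \<Rightarrow> 'a"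
  assumes Q: "order_projection Q"
  shows "band_projection_onto {x. Q x = x} Q"
proof -
  have "inf \<bar>x - Q x\<bar> \<bar>y\<bar> = 0" if "Q y = y" for x y
    using order_projection_disjoint[OF Q, of y x] that by (simp add: inf_commute)
  then show ?thesis
    using order_projection_band_range[OF Q] order_projection_idem[OF Q]
    by (simp add: band_projection_onto_def disjoint_complement_def)
qed

lemma order_projection_imp_band_projection:
  fixes Q :: "'a::dedekind_complete_riesz_space \<Rightarrow> 'a"
  shows "order_projection Q \<Longrightarrow> band_projection Q"
  using order_projection_onto_range by (auto simp: band_projection_def)

lemma band_hull: "band (band hull A)" for A :: "'a::dedekind_complete_riesz_space set"
proof (rule hull_in)
  fix \<B> :: "'a set set" assume \<B>: "Ball \<B> band"
  show "band (\<Inter>\<B>)"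
    unfolding band_def riesz_ideal_def
  proof (intro conjI allI impI)
    show "subspace (\<Inter>\<B>)" using \<B> by (auto intro: subspace_Inter band_subspace)
    show "x \<in> \<Inter>\<B>" if "y \<in> \<Inter>\<B> \<and> \<bar>x\<bar> \<le> \<bar>y\<bar>" for x y
      using \<B> that by (blast intro: band_solid)
    show "Sup D \<in> \<Inter>\<B>" if "D \<subseteq> \<Inter>\<B>" "D \<noteq> {} \<and> bdd_above D" for D
    proof
      fix C assume "C \<in> \<B>"
      then show "Sup D \<in> C" using \<B> that by (simp add: band_def le_Inf_iff)
    qed
  qed
qed

text \<open>
  As \<open>Q h = h\<close>, the range of \<open>Q\<close> contains the band of \<open>h\<close>. Conversely, the band of \<open>h\<close> contains
  \<open>Q e\<close>; its preimage under \<open>Q\<close> is a band that contains the weak order unit \<open>e\<close>, and hence is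
  everything.
\<close>
lemma proj_band_gen_eqI:
  fixes Q :: "'a::dedekind_complete_riesz_space \<Rightarrow> 'a"
  assumes Q: "order_projection Q" and e: "weak_order_unit e"
    and h: "Q h = h" and le: "Q e \<le> h"
  shows "proj_band_gen h = Q"
proof -
  let ?B = "band hull {h}"
  have e0: "0 \<le> e" and eU: "band hull {e} = UNIV" using e by (auto simp: weak_order_unit_def)
  have B: "band ?B" by (rule band_hull)
  have hB: "h \<in> ?B" by (simp add: hull_inc)
  have Qe0: "0 \<le> Q e" by (rule order_projection_nonneg[OF Q e0])
  then have "Q e \<in> ?B"
    by (intro band_solid[OF B hB]) (use le Qe0 in \<open>auto intro: order_trans\<close>)
  then have "band hull {e} \<subseteq> {x. Q x \<in> ?B}"
    by (intro hull_minimal order_projection_band_vimage Q B) simp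
  then have in_B: "Q x \<in> ?B" for x using eU by auto
  have "?B \<subseteq> {x. Q x = x}"
    by (intro hull_minimal order_projection_band_range Q) (simp add: h)
  then have "x - Q x \<in> disjoint_complement ?B" for x
    using order_projection_onto_range[OF Q]
    by (auto simp: band_projection_onto_def disjoint_complement_def)
  with in_B B have onto: "band_projection_onto ?B Q"
    by (auto simp: band_projection_onto_def)
  show ?thesis
    unfolding proj_band_gen_def
  proof (rule the_equality, rule onto)
    fix P assume "band_projection_onto ?B P"
    then show "P = Q"
      using band_projection_onto_unique in_B onto
      unfolding band_projection_onto_def[of _ Q] by blast
  qed
qed


section \<open>Counting occurrences\<close>

text \<open>
  The projection onto the part of the space where the number of occurrences among
  \<open>P 1, \<dots>, P n\<close> lies in \<open>M\<close>. The recursion distinguishes whether \<open>P n\<close> occurs. Arbitrary sets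
  \<open>M\<close> are allowed because the bands of \<open>(S - je)\<^sup>+\<close> and \<open>(S - je)\<^sup>-\<close> belong to tails
  of the distribution and not to single values.
\<close>
fun count_event :: "(nat \<Rightarrow> 'a \<Rightarrow> 'a) \<Rightarrow> nat \<Rightarrow> nat set \<Rightarrow> 'a::riesz_space \<Rightarrow> 'a" where
  "count_event P 0 M x = (if 0 \<in> M then x else 0)"
| "count_event P (Suc n) M x =
     P (Suc n) (count_event P n {i. Suc i \<in> M} x) +
     (count_event P n M x - P (Suc n) (count_event P n M x))"

context
  fixes P :: "nat \<Rightarrow> 'a::riesz_space \<Rightarrow> 'a"
  assumes P: "\<And>k. 1 \<le> k \<Longrightarrow> order_projection (P k)"
begin

lemma order_projection_count_event: "order_projection (count_event P n M)"
proof (induction n arbitrary: M)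
  case 0
  have "count_event P 0 M = (if 0 \<in> M then (\<lambda>x. x) else (\<lambda>x. 0))" by auto
  then show ?case by (simp add: order_projection_def linear_ident linear_zero)
next
  case (Suc n)
  have "count_event P (Suc n) M =
      (\<lambda>x. P (Suc n) (count_event P n {i. Suc i \<in> M} x) +
        (count_event P n M x - P (Suc n) (count_event P n M x)))"
    by (rule ext) simp
  then show ?case using order_projection_splice[OF P Suc.IH Suc.IH, of "Suc n"] by simp
qed

lemma count_event_empty: "count_event P n {} x = 0"
  by (induction n) (simp_all add: order_projection_0[OF P])

lemma count_event_UNIV: "count_event P n UNIV x = x"
  by (induction n) simp_all

lemma count_event_Un_disjoint:
  "M \<inter> N = {} \<Longrightarrow> count_event P n (M \<union> N) x = count_event P n M x + count_event P n N x"
proof (induction n arbitrary: M N)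
  case (Suc n)
  have "{i. Suc i \<in> M \<union> N} = {i. Suc i \<in> M} \<union> {i. Suc i \<in> N}"
    "{i. Suc i \<in> M} \<inter> {i. Suc i \<in> N} = {}" using Suc.prems by auto
  then show ?case
    using Suc by (simp add: order_projection_add[OF P])
qed auto

text \<open>
  Composition of projections is a lattice operation on their values at \<open>e\<close>, and so a Riesz
  subspace that contains all \<open>P k e\<close> contains every event that they determine.
\<close>
lemma count_event_in_riesz_subspace:
  assumes G: "riesz_subspace G" "e \<in> G" "0 \<le> e" and PG: "\<And>k. k \<in> {1..n} \<Longrightarrow> P k e \<in> G"
  shows "count_event P n M e \<in> G"
  using PG
proof (induction n arbitrary: M)
  case 0
  then show ?case using G by (auto simp: riesz_subspace_def subspace_0)
next
  case (Suc n)
  have IH: "count_event P n M e \<in> G" for M using Suc by auto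
  have "P (Suc n) (count_event P n M e) \<in> G" for M
  proof -
    have "P (Suc n) (count_event P n M e) = inf (P (Suc n) e) (count_event P n M e)"
      by (rule order_projection_comp_eq_inf[OF P order_projection_count_event G(3)]) simp
    then show ?thesis using Suc.prems[of "Suc n"] IH[of M] G(1) by (auto simp: riesz_subspace_def)
  qed
  then show ?case
    using IH G(1) by (auto simp: riesz_subspace_def intro: subspace_add subspace_diff)
qed

text \<open>
  Where \<open>P (Suc n)\<close> occurs, its summand adds \<open>e\<close>; elsewhere it adds \<open>0\<close>. This step drives the
  two bounds for the sum that follow.
\<close>
lemma count_event_Suc_sum:
  "count_event P (Suc n) M (\<Sum>j=1..Suc n. P j e) =
     P (Suc n) (count_event P n {i. Suc i \<in> M} (\<Sum>j=1..n. P j e) +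
       count_event P n {i. Suc i \<in> M} e) +
     (count_event P n M (\<Sum>j=1..n. P j e) - P (Suc n) (count_event P n M (\<Sum>j=1..n. P j e)))"
proof -
  have p: "order_projection (P (Suc n))" by (rule P) simp
  have c: "count_event P n M (P (Suc n) e) = P (Suc n) (count_event P n M e)" for M
    by (rule order_projection_commute[OF order_projection_count_event p])
  show ?thesis
    by (simp add: c order_projection_add[OF order_projection_count_event]
        order_projection_add[OF p] order_projection_idem[OF p])
qed

context
  fixes e :: 'a
  assumes e: "0 \<le> e"
begin

lemma count_event_sum_ge:
  "M \<subseteq> {j..} \<Longrightarrow> real j *\<^sub>R count_event P n M e \<le> count_event P n M (\<Sum>j=1..n. P j e)"
proof (induction n arbitrary: M j)
  case 0
  then show ?case by auto
next
  case (Suc n)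
  have p: "order_projection (P (Suc n))" by (rule P) simp
  show ?case
  proof (cases j)
    case 0
    have "0 \<le> (\<Sum>j=1..Suc n. P j e)"
      by (intro sum_nonneg) (simp add: order_projection_nonneg[OF P e])
    from order_projection_nonneg[OF order_projection_count_event this]
    show ?thesis by (simp only: 0 of_nat_0 scaleR_zero_left)
  next
    case (Suc i)
    have "real j *\<^sub>R count_event P (Suc n) M e =
        P (Suc n) (real i *\<^sub>R count_event P n {i. Suc i \<in> M} e + count_event P n {i. Suc i \<in> M} e)
        + (real j *\<^sub>R count_event P n M e - P (Suc n) (real j *\<^sub>R count_event P n M e))"
      by (simp add: Suc order_projection_add[OF p] order_projection_scale[OF p] scaleR_right_distrib
          scaleR_left_distrib scaleR_right_diff_distrib)
    also have "\<dots> \<le> count_event P (Suc n) M (\<Sum>j=1..Suc n. P j e)"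
      unfolding count_event_Suc_sum
      using Suc.prems Suc
      by (intro add_mono order_projection_mono[OF p] order_projection_compl_mono[OF p]
          order_refl Suc.IH) auto
    finally show ?thesis .
  qed
qed

lemma count_event_sum_le:
  "M \<subseteq> {..j} \<Longrightarrow> count_event P n M (\<Sum>j=1..n. P j e) \<le> real j *\<^sub>R count_event P n M e"
proof (induction n arbitrary: M j)
  case 0
  then show ?case by (auto simp: e scaleR_nonneg_nonneg)
next
  case (Suc n)
  have p: "order_projection (P (Suc n))" by (rule P) simp
  note rest = order_projection_compl_mono[OF p Suc.IH[OF Suc.prems]]
  show ?case
  proof (cases j)
    case 0
    then have "{i. Suc i \<in> M} = {}" using Suc.prems by auto
    then show ?thesis
      unfolding count_event_Suc_sum
      using rest by (simp add: 0 count_event_empty order_projection_0[OF p])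
  next
    case (Suc i)
    have "count_event P (Suc n) M (\<Sum>j=1..Suc n. P j e) \<le>
        P (Suc n) (real i *\<^sub>R count_event P n {i. Suc i \<in> M} e + count_event P n {i. Suc i \<in> M} e)
        + (real j *\<^sub>R count_event P n M e - P (Suc n) (real j *\<^sub>R count_event P n M e))"
      unfolding count_event_Suc_sum
      using Suc.prems Suc
      by (intro add_mono order_projection_mono[OF p] order_projection_compl_mono[OF p]
          order_refl Suc.IH) auto
    also have "\<dots> = real j *\<^sub>R count_event P (Suc n) M e"
      by (simp add: Suc order_projection_add[OF p] order_projection_scale[OF p] scaleR_right_distrib
          scaleR_left_distrib scaleR_right_diff_distrib)
    finally show ?thesis .
  qed
qed

end

end

lemma pprt_diff_disjoint:
  fixes a b :: "'a::riesz_space"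
  assumes "inf a b = 0"
  shows "pprt (a - b) = a"
proof -
  have "pprt (a - b) = sup a b - b"
    by (simp add: pprt_def add_sup_distrib_right diff_conv_add_uminus del: add_uminus_conv_diff)
  also have "\<dots> = a" using add_eq_inf_sup[of a b] assms by (metis add.right_neutral add_diff_cancel_right')
  finally show ?thesis .
qed

text \<open>
  With \<open>y = S - je\<close>, the tail \<open>{j<..}\<close> carries \<open>y\<^sup>+\<close>, the tail \<open>{..<j}\<close> carries \<open>y\<^sup>-\<close>, and \<open>y\<close>
  vanishes on \<open>{j}\<close>. As the counts are integers, \<open>\<bar>y\<bar> \<ge> e\<close> on both tails, and the two
  bands generated by \<open>y\<^sup>+\<close> and \<open>y\<^sup>-\<close> are the whole tails.
\<close>
lemma proj_eq_sum_eq_count_event: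
  fixes P :: "nat \<Rightarrow> 'a::dedekind_complete_riesz_space \<Rightarrow> 'a"
  assumes P: "\<And>k. 1 \<le> k \<Longrightarrow> order_projection (P k)" and e: "weak_order_unit e"
  shows "proj_eq (\<Sum>j=1..n. P j e) (real j *\<^sub>R e) e = count_event P n {j} e"
proof -
  have e0: "0 \<le> e" using e by (simp add: weak_order_unit_def)
  define A where "A = count_event P n {j<..}"
  define B where "B = count_event P n {..<j}"
  define R where "R = count_event P n {j}"
  define y where "y = (\<Sum>j=1..n. P j e) - real j *\<^sub>R e"
  have A: "order_projection A" and B: "order_projection B" and R: "order_projection R"
    unfolding A_def B_def R_def by (rule order_projection_count_event[OF P], assumption)+
  have split: "x = A x + B x + R x" for x
  proof -
    have U: "UNIV = ({j<..} \<union> {..<j}) \<union> {j}" by auto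
    have "x = count_event P n UNIV x" by (simp add: count_event_UNIV[OF P])
    also have "\<dots> = A x + B x + R x"
      unfolding U A_def B_def R_def
      by (subst count_event_Un_disjoint[OF P], assumption, force)+ (rule refl)
    finally show ?thesis .
  qed
  have Ay: "A e \<le> A y"
  proof -
    have "real (Suc j) *\<^sub>R A e \<le> A (\<Sum>j=1..n. P j e)"
      unfolding A_def by (rule count_event_sum_ge[OF P e0]) auto
    then show ?thesis
      by (simp add: y_def order_projection_diff[OF A] order_projection_scale[OF A] algebra_simps)
  qed
  have By: "B e \<le> - B y"
  proof (cases j)
    case 0
    then show ?thesis by (simp add: B_def count_event_empty[OF P])
  next
    case (Suc i)
    have "B (\<Sum>j=1..n. P j e) \<le> real i *\<^sub>R B e"
      unfolding B_def by (rule count_event_sum_le[OF P e0]) (auto simp: Suc)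
    then show ?thesis
      by (simp add: Suc y_def order_projection_diff[OF B] order_projection_add[OF B]
          order_projection_scale[OF B] algebra_simps)
  qed
  have "R (\<Sum>j=1..n. P j e) = real j *\<^sub>R R e"
    unfolding R_def
    by (intro antisym count_event_sum_ge[OF P e0] count_event_sum_le[OF P e0]) auto
  then have "R y = 0"
    by (simp add: y_def order_projection_diff[OF R] order_projection_scale[OF R])
  then have y: "y = A y + B y" using split[of y] by simp
  have pos: "0 \<le> A y" "0 \<le> - B y"
    using Ay By order_projection_nonneg[OF A e0] order_projection_nonneg[OF B e0] by (meson order_trans)+
  have "y - A y = B y" using y by (metis add_diff_cancel_left')
  then have "inf \<bar>A y\<bar> \<bar>B y\<bar> = 0"
    using order_projection_disjoint[OF A, of y y] by simp
  then have disj: "inf (A y) (- B y) = 0"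
    using pos by (metis abs_minus_cancel abs_of_nonneg)
  have "pprt y = A y"
    using pprt_diff_disjoint[OF disj] y by simp
  then have gA: "proj_band_gen (pprt y) = A"
    using proj_band_gen_eqI[OF A e order_projection_idem[OF A] Ay] by simp
  have "- y = - B y - A y" using y by (simp add: eq_neg_iff_add_eq_0 algebra_simps)
  then have "pprt (- y) = - B y"
    using pprt_diff_disjoint[of "- B y" "A y"] disj by (simp add: inf_commute)
  then have gB: "proj_band_gen (pprt (- y)) = B"
    using proj_band_gen_eqI[OF B e _ By] order_projection_idem[OF B] order_projection_neg[OF B] by simp
  have "A (B e) = 0"
  proof (rule order_projection_kills_below[OF A order_projection_nonneg[OF B e0]])
    show "B e \<le> e - A e"
      using split[of e] order_projection_nonneg[OF R e0]
      by (metis add.commute add_diff_cancel_left' add.assoc le_add_same_cancel1)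
    show "A (e - A e) = 0" by (simp add: order_projection_diff[OF A] order_projection_idem[OF A])
  qed
  then have "proj_eq (\<Sum>j=1..n. P j e) (real j *\<^sub>R e) e = e - B e - A e"
    using gA gB unfolding proj_eq_def y_def by (simp add: order_projection_diff[OF A])
  also have "\<dots> = R e" using split[of e] by (metis add.commute add_diff_cancel_left' diff_diff_add)
  finally show ?thesis by (simp add: R_def)
qed


section \<open>Operators that agree at the unit\<close>

text \<open>
  Every lattice-ordered group is distributive: in \<open>w = inf x w - x + sup x w\<close> the right hand
  side is bounded by the same element for \<open>w = y\<close> and for \<open>w = z\<close>.
\<close>
lemma inf_sup_le:
  fixes x y z :: "'a::riesz_space"
  shows "inf x (sup y z) \<le> sup (inf x y) (inf x z)"
proof -
  let ?u = "sup (inf x y) (inf x z)"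
  have bound: "w \<le> ?u - x + sup x (sup y z)" if "w = y \<or> w = z" for w
  proof -
    have "w = inf x w - x + sup x w" using add_eq_inf_sup[of x w] by (simp add: algebra_simps)
    also have "\<dots> \<le> ?u - x + sup x (sup y z)"
      using that by (intro add_mono diff_right_mono sup_mono) auto
    finally show ?thesis .
  qed
  have "sup y z \<le> ?u - x + sup x (sup y z)" by (rule sup_least) (auto intro: bound)
  then show ?thesis using add_eq_inf_sup[of x "sup y z"] by (simp add: algebra_simps)
qed

text \<open>
  Dedekind complete spaces are Archimedean: translation by \<open>z\<close> maps the set of multiples of \<open>z\<close>
  into itself, and so \<open>s - z\<close> is an upper bound of it whenever \<open>s\<close> is; take the least one.
\<close>
lemma archimedean_nonpos:
  fixes z d :: "'a::dedekind_complete_riesz_space"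
  assumes "\<And>n. real n *\<^sub>R z \<le> d"
  shows "z \<le> 0"
proof -
  let ?A = "range (\<lambda>n. real n *\<^sub>R z)"
  have bdd: "bdd_above ?A" using assms by (auto intro: bdd_aboveI[of _ d])
  have "real n *\<^sub>R z \<le> Sup ?A - z" for n
    using cSup_upper[OF rangeI[of _ "Suc n"] bdd] by (simp add: algebra_simps)
  then have "Sup ?A \<le> Sup ?A - z" by (intro cSup_least) auto
  then show ?thesis by simp
qed

text \<open>
  Read pointwise: a number \<open>g \<ge> 0\<close> either exceeds \<open>n d\<close> or lies within \<open>d\<close> of one of the grid
  points \<open>0, d, \<dots>, n d\<close>. Distributivity replaces the pointwise case distinction.
\<close>
lemma le_step_of_grid_distances:
  fixes d g z :: "'a::riesz_space"
  assumes d: "0 \<le> d" and g: "0 \<le> g" and z: "\<And>k. k \<le> n \<Longrightarrow> z \<le> \<bar>g - real k *\<^sub>R d\<bar>"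
  shows "z \<le> sup d (g - real n *\<^sub>R d)"
  using z
proof (induction n)
  case 0
  then show ?case using g by (auto intro: le_supI2)
next
  case (Suc n)
  define a where "a = g - real (Suc n) *\<^sub>R d"
  have "g - real n *\<^sub>R d = a + d" by (simp add: a_def algebra_simps)
  then have "z \<le> sup d (a + d)" using Suc by simp
  moreover have za: "z \<le> \<bar>a\<bar>" using Suc.prems[of "Suc n"] by (simp add: a_def)
  ultimately have "z \<le> inf \<bar>a\<bar> (sup d (a + d))" by simp
  also have "\<dots> \<le> sup (inf \<bar>a\<bar> d) (inf \<bar>a\<bar> (a + d))" by (rule inf_sup_le)
  also have "\<dots> \<le> sup d a"
  proof (rule sup_least)
    let ?w = "inf (a + d) (- a)"
    have "?w + ?w \<le> (a + d) + - a" by (intro add_mono) simp_all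
    also have "\<dots> \<le> d + d" using d by simp
    finally have "(?w - d) + (?w - d) \<le> 0" by (simp add: algebra_simps)
    then have w: "?w \<le> d" by simp
    have "inf \<bar>a\<bar> (a + d) \<le> sup (inf (a + d) a) ?w"
      using inf_sup_le[of "a + d" a "- a"] by (simp add: abs_lattice inf_commute)
    also have "\<dots> \<le> sup d a" using w by (auto intro: le_supI1 le_supI2 inf.coboundedI2)
    finally show "inf \<bar>a\<bar> (a + d) \<le> sup d a" .
  qed (auto intro: le_supI1)
  finally show ?case by (simp add: a_def)
qed

lemma lattice_hom_abs:
  fixes J :: "'a::riesz_space \<Rightarrow> 'u::riesz_space"
  assumes "linear J" "\<And>x y. J (sup x y) = sup (J x) (J y)"
  shows "J \<bar>x\<bar> = \<bar>J x\<bar>"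
  using assms by (simp add: abs_lattice linear_neg)

lemma lattice_hom_mono:
  fixes J :: "'a::lattice \<Rightarrow> 'u::lattice"
  assumes "\<And>x y. J (sup x y) = sup (J x) (J y)" "x \<le> y"
  shows "J x \<le> J y"
  using assms by (metis sup.absorb_iff2)

text \<open>
  This takes the place of a spectral theorem. Put \<open>D = A - B\<close>. Since \<open>D e = 0\<close>, subtracting \<open>t e\<close>
  from \<open>g\<close> does not change \<open>D g\<close>, and so \<open>\<bar>D g\<bar> \<le> 2 \<bar>J g - t J e\<bar>\<close> for every real \<open>t\<close>. The
  infimum of the right hand side over all \<open>t\<close> is \<open>0\<close>: a grid of mesh \<open>1/n\<close> already brings it below
  \<open>(2/n) J e\<close>.
\<close>
lemma dominated_operators_agree:
  fixes A B J :: "'a::riesz_space \<Rightarrow> 'u::dedekind_complete_riesz_space"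
  assumes A: "linear A" "\<And>x. x \<in> F \<Longrightarrow> \<bar>A x\<bar> \<le> \<bar>J x\<bar>"
    and B: "linear B" "\<And>x. x \<in> F \<Longrightarrow> \<bar>B x\<bar> \<le> \<bar>J x\<bar>"
    and J: "linear J" "\<And>x y. J (sup x y) = sup (J x) (J y)"
    and F: "subspace F" "e \<in> F" and eq: "A e = B e"
    and g: "g \<in> F" "0 \<le> g" "g \<le> e"
  shows "A g = B g"
proof -
  let ?z = "(1/2) *\<^sub>R \<bar>A g - B g\<bar>"
  have J0: "0 \<le> J g" "J g \<le> J e"
    using lattice_hom_mono[of J, OF J(2)] g linear_0[OF J(1)] by metis+
  have dist: "?z \<le> \<bar>J g - t *\<^sub>R J e\<bar>" for t
  proof -
    let ?x = "g - t *\<^sub>R e"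
    have x: "?x \<in> F" by (intro subspace_diff subspace_scale F g)
    have "A g - B g = A ?x - B ?x"
      by (simp add: linear_diff[OF A(1)] linear_diff[OF B(1)] linear_scale[OF A(1)]
          linear_scale[OF B(1)] eq)
    also have "\<bar>\<dots>\<bar> \<le> \<bar>A ?x\<bar> + \<bar>B ?x\<bar>" by (rule abs_triangle_ineq4)
    also have "\<dots> \<le> \<bar>J ?x\<bar> + \<bar>J ?x\<bar>" by (intro add_mono A B x)
    also have "\<dots> = 2 *\<^sub>R \<bar>J g - t *\<^sub>R J e\<bar>"
      by (simp add: linear_diff[OF J(1)] linear_scale[OF J(1)] scaleR_2)
    finally have "?z \<le> (1/2) *\<^sub>R (2 *\<^sub>R \<bar>J g - t *\<^sub>R J e\<bar>)"
      by (intro scaleR_left_mono) auto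
    then show ?thesis by simp
  qed
  have "real n *\<^sub>R ?z \<le> J e" for n
  proof (cases "n = 0")
    case True
    then show ?thesis using J0 by (simp add: order_trans)
  next
    case False
    let ?d = "(1 / real n) *\<^sub>R J e"
    have d0: "0 \<le> ?d" using J0 by (intro scaleR_nonneg_nonneg) (auto intro: order_trans)
    have "?z \<le> sup ?d (J g - real n *\<^sub>R ?d)"
      by (rule le_step_of_grid_distances[OF d0 J0(1)]) (use dist in simp)
    also have "\<dots> = ?d"
    proof (rule sup_absorb1)
      have "J g - real n *\<^sub>R ?d \<le> 0" using False J0 by simp
      then show "J g - real n *\<^sub>R ?d \<le> ?d" using d0 by (rule order_trans)
    qed
    finally have "real n *\<^sub>R ?z \<le> real n *\<^sub>R ?d" by (intro scaleR_left_mono) auto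
    then show ?thesis using False by simp
  qed
  then have "?z \<le> 0" by (rule archimedean_nonpos)
  then have "2 *\<^sub>R ?z \<le> 2 *\<^sub>R 0" by (intro scaleR_left_mono) auto
  then have "\<bar>A g - B g\<bar> \<le> 0" by simp
  then show ?thesis by simp
qed

section \<open>Multiplication and averaging\<close>

context
  fixes J :: "'a::riesz_space \<Rightarrow> 'u::dedekind_complete_riesz_space"
    and mul :: "'u \<Rightarrow> 'u \<Rightarrow> 'u" and e :: 'a
  assumes J: "linear J" "\<And>x y. J (sup x y) = sup (J x) (J y)"
    and mul: "f_algebra_mult mul" and unit: "\<And>x. mul (J e) x = x" "\<And>x. mul x (J e) = x"
    and e: "0 \<le> e"
begin

lemma mult_unit_interval_abs_le:
  assumes a: "0 \<le> a" "a \<le> J e"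
  shows "\<bar>mul a y\<bar> \<le> \<bar>y\<bar>" "\<bar>mul y a\<bar> \<le> \<bar>y\<bar>"
proof -
  have linl: "linear (mul x)" and linr: "linear (\<lambda>x. mul x y)"
    and pos: "0 \<le> x \<Longrightarrow> 0 \<le> y \<Longrightarrow> 0 \<le> mul x y" for x y
    using mul by (auto simp: f_algebra_mult_def)
  have bound: "h y \<le> \<bar>y\<bar>"
    if h: "linear h" "\<And>x. 0 \<le> x \<Longrightarrow> 0 \<le> h x" "\<And>x. 0 \<le> x \<Longrightarrow> h x \<le> x" for h :: "'u \<Rightarrow> 'u" and y
  proof -
    have "0 \<le> h (\<bar>y\<bar> - y)" by (rule h(2)) (simp add: abs_ge_self)
    then have "h y \<le> h \<bar>y\<bar>" by (simp add: linear_diff[OF h(1)])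
    also have "\<dots> \<le> \<bar>y\<bar>" by (rule h(3)) simp
    finally show ?thesis .
  qed
  have abs_bound: "\<bar>h y\<bar> \<le> \<bar>y\<bar>"
    if h: "linear h" "\<And>x. 0 \<le> x \<Longrightarrow> 0 \<le> h x" "\<And>x. 0 \<le> x \<Longrightarrow> h x \<le> x" for h :: "'u \<Rightarrow> 'u" and y
    using bound[OF h, of y] bound[OF h, of "- y"] by (intro abs_leI) (auto simp: linear_neg[OF h(1)])
  show "\<bar>mul a y\<bar> \<le> \<bar>y\<bar>"
  proof (rule abs_bound[OF linl pos[OF a(1)]])
    show "mul a x \<le> x" if "0 \<le> x" for x
      using pos[of "J e - a" x] that a(2) linear_diff[OF linr] unit by simp
  qed
  show "\<bar>mul y a\<bar> \<le> \<bar>y\<bar>"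
  proof (rule abs_bound[OF linr])
    show "0 \<le> mul x a" if "0 \<le> x" for x using pos that a by simp
    show "mul x a \<le> x" if "0 \<le> x" for x
      using pos[of x "J e - a"] that a(2) linear_diff[OF linl] unit by simp
  qed
qed

lemma J_unit_interval:
  assumes "0 \<le> x" "x \<le> e"
  shows "0 \<le> J x" "J x \<le> J e"
  using lattice_hom_mono[of J, OF J(2)] assms linear_0[OF J(1)] by metis+

lemma linear_mult_J: "linear (\<lambda>x. mul a (J x))" "linear (\<lambda>x. mul (J x) a)"
proof -
  have "linear (mul a)" "linear (\<lambda>x. mul x a)"
    using mul by (auto simp: f_algebra_mult_def)
  from this[THEN linear_compose[OF J(1)]]
  show "linear (\<lambda>x. mul a (J x))" "linear (\<lambda>x. mul (J x) a)" by (simp_all add: o_def)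
qed

text \<open>
  Applying \<open>Q\<close> is multiplication by \<open>Q e\<close>: both operations are dominated by the identity, and they
  agree at the unit \<open>e\<close>.
\<close>
lemma order_projection_eq_mult:
  assumes Q: "order_projection Q" and x: "0 \<le> x" "x \<le> e"
  shows "mul (J (Q e)) (J x) = J (Q x)" "mul (J x) (J (Q e)) = J (Q x)"
proof -
  have Qe: "0 \<le> J (Q e)" "J (Q e) \<le> J e"
    by (rule J_unit_interval order_projection_nonneg[OF Q e] order_projection_le[OF Q e])+
  have lin: "linear (\<lambda>x. J (Q x))"
    using linear_compose[OF order_projection_linear[OF Q] J(1)] by (simp add: o_def)
  have bd: "\<bar>J (Q x)\<bar> \<le> \<bar>J x\<bar>" for x
  proof -
    have "\<bar>Q x\<bar> \<le> \<bar>x\<bar>"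
      using order_projection_abs_le[OF Q] order_projection_le[OF Q, of "\<bar>x\<bar>"] by (auto intro: order_trans)
    from lattice_hom_mono[of J, OF J(2) this] show ?thesis by (simp only: lattice_hom_abs[OF J])
  qed
  show "mul (J (Q e)) (J x) = J (Q x)"
    by (rule dominated_operators_agree[OF linear_mult_J(1) mult_unit_interval_abs_le(1)[OF Qe]
          lin bd J, of UNIV e]) (use x unit in auto)
  show "mul (J x) (J (Q e)) = J (Q x)"
    by (rule dominated_operators_agree[OF linear_mult_J(2) mult_unit_interval_abs_le(2)[OF Qe]
          lin bd J, of UNIV e]) (use x unit in auto)
qed

text \<open>
  On the range of \<open>T\<close> the operator \<open>T \<circ> Q\<close> is multiplication by \<open>T (Q e)\<close>. The domination
  \<open>\<bar>T (Q x)\<bar> \<le> T \<bar>x\<bar> = \<bar>x\<bar>\<close> holds only on the range, which is closed under absolute values.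
\<close>
lemma averaging:
  assumes T: "linear T" "\<And>x. 0 \<le> x \<Longrightarrow> 0 \<le> T x" "\<And>x. T (T x) = T x"
    "riesz_subspace (range T)" "T e = e"
    and Q: "order_projection Q" and x: "x \<in> range T" "0 \<le> x" "x \<le> e"
  shows "mul (J (T (Q e))) (J x) = J (T (Q x))"
proof -
  have mono: "T x \<le> T y" if "x \<le> y" for x y
    using T(2)[of "y - x"] that linear_diff[OF T(1)] by simp
  have TQe: "0 \<le> J (T (Q e))" "J (T (Q e)) \<le> J e"
    using T(2) mono[OF order_projection_le[OF Q e]] order_projection_nonneg[OF Q e] T(5)
    by (auto intro: J_unit_interval)
  have lin: "linear (\<lambda>x. J (T (Q x)))"
    using linear_compose[OF order_projection_linear[OF Q] linear_compose[OF T(1) J(1)]]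
    by (simp add: o_def)
  have bd: "\<bar>J (T (Q x))\<bar> \<le> \<bar>J x\<bar>" if x: "x \<in> range T" for x
  proof -
    have S: "subspace (range T)" using T(4) by (simp add: riesz_subspace_def)
    have "- x \<in> range T" using subspace_neg[OF S x] .
    then have "\<bar>x\<bar> \<in> range T"
      using T(4) x unfolding abs_lattice riesz_subspace_def by blast
    then have Tx: "T \<bar>x\<bar> = \<bar>x\<bar>" using T(3) by auto
    have "Q x \<le> \<bar>x\<bar>" "- Q x \<le> \<bar>x\<bar>"
      using order_projection_abs_le[OF Q, of x] order_projection_le[OF Q, of "\<bar>x\<bar>"]
      by (meson abs_ge_self abs_ge_minus_self abs_ge_zero order_trans)+
    from this[THEN mono] have "\<bar>T (Q x)\<bar> \<le> \<bar>x\<bar>"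
      by (intro abs_leI) (simp_all add: Tx linear_neg[OF T(1)])
    from lattice_hom_mono[of J, OF J(2) this] show ?thesis by (simp only: lattice_hom_abs[OF J])
  qed
  show ?thesis
  proof (rule dominated_operators_agree[OF linear_mult_J(1) mult_unit_interval_abs_le(1)[OF TQe]
        lin bd J])
    show "subspace (range T)" using T(4) by (simp add: riesz_subspace_def)
    show "e \<in> range T" using T(5) by (metis rangeI)
  qed (use x unit in auto)
qed

end


section \<open>Moments of independent projections\<close>

lemma closed_riesz_subspace_generated_riesz_subspace:
  "riesz_subspace (closed_riesz_subspace_generated A)"
proof -
  have Inter: "riesz_subspace (\<Inter>\<F>)" if "\<And>F. F \<in> \<F> \<Longrightarrow> riesz_subspace F" for \<F> :: "'a set set"
    using that by (auto simp: riesz_subspace_def intro: subspace_Inter)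
  show ?thesis unfolding closed_riesz_subspace_generated_def hull_def by (rule Inter) simp
qed

lemma closed_riesz_subspace_generated_superset: "A \<subseteq> closed_riesz_subspace_generated A"
  unfolding closed_riesz_subspace_generated_def by (rule hull_subset)

text \<open>
  The subspace \<open>G\<close> is generated by all indices except \<open>i\<close>, not merely by those below \<open>i\<close>: for
  \<open>i = 1\<close> the latter would be generated by the empty set and would contain only \<open>0\<close>.
\<close>
lemma independent_of_the_others:
  fixes P :: "nat \<Rightarrow> 'a::dedekind_complete_riesz_space \<Rightarrow> 'a"
  assumes indep: "indep_projection_seq T e P" and e: "T e = e" and i: "1 \<le> i"
  obtains G where "riesz_subspace G" "e \<in> G" "\<And>k. 1 \<le> k \<Longrightarrow> k \<noteq> i \<Longrightarrow> P k e \<in> G"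
    "\<And>Q. order_projection Q \<Longrightarrow> Q e \<in> G \<Longrightarrow> T (P i (Q e)) = T (P i (T (Q e)))"
proof -
  let ?F = "\<lambda>k. closed_riesz_subspace_generated ({P k e} \<union> range T)"
  let ?G = "\<lambda>L. closed_riesz_subspace_generated (\<Union>k\<in>L. ?F k)"
  have F: "P k e \<in> ?F k" "e \<in> ?F k" for k
    using closed_riesz_subspace_generated_superset[of "{P k e} \<union> range T"] rangeI[of T e] e by auto
  have G: "P k e \<in> ?G L" "e \<in> ?G L" if "k \<in> L" for k L
    using closed_riesz_subspace_generated_superset[of "\<Union>k\<in>L. ?F k"] F[of k] that by blast+
  let ?L = "{1..} - {i}"
  have sub: "indep_subspaces T e (?G L) (?G M)"
    if "L \<subseteq> {1..}" "M \<subseteq> {1..}" "L \<inter> M = {}" for L M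
    using indep that unfolding indep_projection_seq_def indep_family_def by blast
  have *: "indep_subspaces T e (?G {i}) (?G ?L)" by (rule sub) (use i in auto)
  show thesis
  proof (rule that)
    show "riesz_subspace (?G ?L)" by (rule closed_riesz_subspace_generated_riesz_subspace)
    show "e \<in> ?G ?L" by (rule G(2)[of "Suc i"]) auto
    show "P k e \<in> ?G ?L" if "1 \<le> k" "k \<noteq> i" for k by (rule G(1)) (use that in auto)
    show "T (P i (Q e)) = T (P i (T (Q e)))" if Q: "order_projection Q" "Q e \<in> ?G ?L" for Q
    proof -
      have "band_projection (P i)" using indep i by (simp add: indep_projection_seq_def)
      moreover have "band_projection Q" by (rule order_projection_imp_band_projection[OF Q(1)])
      moreover have "P i e \<in> ?G {i}" by (rule G(1)) simp
      ultimately have "indep_projections T e (P i) Q"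
        using * Q(2) unfolding indep_subspaces_def by blast
      then show ?thesis by (simp add: indep_projections_def)
    qed
  qed
qed

lemma funpow_mult_distrib:
  assumes "f_algebra_mult mul" and "\<And>x. mul u x = x"
  shows "mul (mult_power u mul a n) x = (mul a ^^ n) x"
  using assms by (induction n) (simp_all add: mult_power_def f_algebra_mult_def)

locale bernoulli_projections =
  fixes T :: "'a::dedekind_complete_riesz_space \<Rightarrow> 'a"
    and J :: "'a \<Rightarrow> 'u::dedekind_complete_riesz_space"
    and mul :: "'u \<Rightarrow> 'u \<Rightarrow> 'u"
    and e f :: 'a
    and P :: "nat \<Rightarrow> 'a \<Rightarrow> 'a"
  assumes T: "cond_expectation T"
    and J: "universal_completion J"
    and e: "weak_order_unit e" "T e = e"
    and mul: "natural_f_algebra_mult (J e) mul"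
    and indep: "indep_projection_seq T e P"
    and mean: "\<And>j. 1 \<le> j \<Longrightarrow> T (P j e) = f"
begin

lemma T_linear: "linear T" and T_nonneg: "0 \<le> x \<Longrightarrow> 0 \<le> T x" and T_idem: "T (T x) = T x"
  and T_range: "riesz_subspace (range T)"
  using T unfolding cond_expectation_def by (auto simp: fun_eq_iff)

lemmas T_simps = linear_add[OF T_linear] linear_diff[OF T_linear] linear_scale[OF T_linear]
  linear_0[OF T_linear] T_idem

lemma T_mono: "x \<le> y \<Longrightarrow> T x \<le> T y"
  using T_nonneg[of "y - x"] T_simps by simp

lemma J_linear: "linear J" and J_inj: "inj J" and J_sup: "J (sup x y) = sup (J x) (J y)"
  using J by (auto simp: universal_completion_def)

lemmas J_simps = linear_add[OF J_linear] linear_diff[OF J_linear] linear_scale[OF J_linear]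
  linear_0[OF J_linear]

lemma e_nonneg: "0 \<le> e"
  using e by (simp add: weak_order_unit_def)

lemma mul_f_algebra: "f_algebra_mult mul" and mul_unit: "mul (J e) u = u" "mul u (J e) = u"
  using mul by (auto simp: natural_f_algebra_mult_def)

lemma mul_linear_right: "linear (mul u)" and mul_linear_left: "linear (\<lambda>x. mul x u)"
  using mul_f_algebra by (auto simp: f_algebra_mult_def)

lemmas mul_simps = linear_add[OF mul_linear_right] linear_diff[OF mul_linear_right]
  linear_scale[OF mul_linear_right] linear_0[OF mul_linear_right]
  linear_add[OF mul_linear_left] linear_diff[OF mul_linear_left]
  linear_scale[OF mul_linear_left] linear_0[OF mul_linear_left]

lemma P: "1 \<le> k \<Longrightarrow> order_projection (P k)"
  using indep band_projection_imp_order_projection by (auto simp: indep_projection_seq_def)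

lemma f_bounds: "0 \<le> f" "f \<le> e" and T_f: "T f = f"
proof -
  have P1: "order_projection (P 1)" by (rule P) simp
  have f: "f = T (P 1 e)" using mean by simp
  show "0 \<le> f" unfolding f by (intro T_nonneg order_projection_nonneg[OF P1] e_nonneg)
  show "f \<le> e" using T_mono[OF order_projection_le[OF P1 e_nonneg]] f e(2) by simp
  show "T f = f" unfolding f by (rule T_idem)
qed

lemma P_eq_mul:
  assumes "1 \<le> k" "0 \<le> x" "x \<le> e"
  shows "mul (J (P k e)) (J x) = J (P k x)" "mul (J x) (J (P k e)) = J (P k x)"
  using order_projection_eq_mult[OF J_linear J_sup mul_f_algebra mul_unit e_nonneg P] assms
  by auto

text \<open>
  For \<open>x\<close> in the range of \<open>T\<close>, the averaging property reads \<open>T (P k x) = f x\<close>; in particular, the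
  square of \<open>f\<close>, formed in the universal completion, is the element \<open>T (P k f)\<close> of the space.
\<close>
lemma T_P_eq_mul:
  assumes "1 \<le> k" "0 \<le> x" "x \<le> e" "T x = x"
  shows "J (T (P k x)) = mul (J f) (J x)"
proof -
  have "x \<in> range T" using assms(4) by (metis rangeI)
  then show ?thesis
    using averaging[OF J_linear J_sup mul_f_algebra mul_unit e_nonneg T_linear T_nonneg T_idem
        T_range e(2) P] assms mean by simp
qed

lemma T_P_order_projection:
  assumes k: "1 \<le> k" and Q: "order_projection Q" and "T (P k (Q e)) = T (P k (T (Q e)))"
  shows "J (T (P k (Q e))) = mul (J f) (J (T (Q e)))"
  unfolding assms(3)
proof (rule T_P_eq_mul[OF k])
  show "0 \<le> T (Q e)" by (intro T_nonneg order_projection_nonneg[OF Q] e_nonneg)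
  show "T (Q e) \<le> e" using T_mono[OF order_projection_le[OF Q e_nonneg]] e(2) by simp
qed (rule T_idem)

text \<open>
  Independence replaces an event of the first \<open>n\<close> projections by its conditional probability, and
  averaging then turns \<open>P (Suc n)\<close> into the factor \<open>f\<close> and its complement into \<open>e - f\<close>.
\<close>
lemma T_count_event_Suc:
  "J (T (count_event P (Suc n) M e)) =
     mul (J f) (J (T (count_event P n {i. Suc i \<in> M} e))) +
     mul (J (e - f)) (J (T (count_event P n M e)))"
proof -
  \<comment> \<open>\<open>G\<close> contains the events that \<open>P 1, \<dots>, P n\<close> determine.\<close>
  obtain G where G: "riesz_subspace G" "e \<in> G" "\<And>k. 1 \<le> k \<Longrightarrow> k \<noteq> Suc n \<Longrightarrow> P k e \<in> G"
    "\<And>Q. order_projection Q \<Longrightarrow> Q e \<in> G \<Longrightarrow> T (P (Suc n) (Q e)) = T (P (Suc n) (T (Q e)))"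
    by (rule independent_of_the_others[OF indep e(2), of "Suc n"]) auto
  have "J (T (P (Suc n) (count_event P n M e))) = mul (J f) (J (T (count_event P n M e)))" for M
  proof (rule T_P_order_projection)
    show Q: "order_projection (count_event P n M)"
      by (rule order_projection_count_event[OF P])
    have "count_event P n M e \<in> G"
      by (rule count_event_in_riesz_subspace[OF P G(1,2) e_nonneg]) (auto intro: G(3))
    with Q show "T (P (Suc n) (count_event P n M e)) = T (P (Suc n) (T (count_event P n M e)))"
      by (rule G(4))
  qed simp
  then show ?thesis by (simp add: T_simps J_simps mul_simps mul_unit)
qed

text \<open>
  Pascal's rule. The multiplications by \<open>f\<close> and by \<open>e - f\<close> commute, because the second one is the
  identity minus the first one.
\<close>
lemma T_count_event:
  "J (T (count_event P n {j} e)) =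
     real (n choose j) *\<^sub>R (mul (J f) ^^ j) ((mul (J (e - f)) ^^ (n - j)) (J e))"
proof (induction n arbitrary: j)
  case 0
  then show ?case using e(2) by (cases j) (auto simp: T_simps J_simps)
next
  case (Suc n)
  let ?L = "mul (J f)" and ?R = "mul (J (e - f))"
  have R: "?R u = u - ?L u" for u by (simp add: J_simps mul_simps mul_unit)
  have "?R (?L u) = ?L (?R u)" for u by (simp add: R mul_simps)
  then have comm: "?R ((?L ^^ k) u) = (?L ^^ k) (?R u)" for k u
    by (induction k) simp_all
  show ?case
  proof (cases j)
    case 0
    have "{i. Suc i \<in> {0 :: nat}} = {}" by auto
    then show ?thesis
      unfolding T_count_event_Suc
      by (simp add: 0 Suc.IH count_event_empty[OF P] T_simps J_simps mul_simps)
  next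
    case (Suc i)
    have "{i'. Suc i' \<in> {j}} = {i}" using Suc by auto
    then have "J (T (count_event P (Suc n) {j} e)) =
        real (n choose i) *\<^sub>R ?L ((?L ^^ i) ((?R ^^ (n - i)) (J e))) +
        real (n choose Suc i) *\<^sub>R ?R ((?L ^^ Suc i) ((?R ^^ (n - Suc i)) (J e)))"
      unfolding T_count_event_Suc by (simp add: Suc Suc.IH mul_simps)
    also have "real (n choose Suc i) *\<^sub>R ?R ((?L ^^ Suc i) ((?R ^^ (n - Suc i)) (J e))) =
        real (n choose Suc i) *\<^sub>R (?L ^^ Suc i) ((?R ^^ (n - i)) (J e))"
    proof (cases "i < n")
      case True
      then have "n - i = Suc (n - Suc i)" by simp
      then show ?thesis
        by (simp only: comm) (simp only: funpow.simps o_apply)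
    qed (simp add: binomial_eq_0)
    finally show ?thesis by (simp add: Suc scaleR_left_distrib)
  qed
qed

text \<open>
  The covariances. A witness for the product is \<open>P i (P k e) - P i f - P k f + f\<^sup>2\<close>, where the square
  is realised in the space itself as \<open>T (P 1 f)\<close>; each of the last three terms has conditional
  expectation \<open>f\<^sup>2\<close> up to sign, and the first one has \<open>f\<^sup>2\<close> if \<open>i \<noteq> k\<close> and \<open>f\<close> if \<open>i = k\<close>.
\<close>
lemma T_centered_product:
  assumes i: "1 \<le> i" and k: "1 \<le> k"
  obtains c where "mul (J (P i e - f)) (J (P k e - f)) = J c"
    "J (T c) = (if i = k then mul (J f) (J (e - f)) else 0)"
proof
  note p = order_projection_nonneg[OF P e_nonneg] order_projection_le[OF P e_nonneg]
  define q where "q = T (P 1 f)"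
  let ?c = "P i (P k e) - P i f - P k f + q"
  have Tq: "T q = q" by (simp add: q_def T_idem)
  have Jq: "J q = mul (J f) (J f)"
    unfolding q_def by (rule T_P_eq_mul) (simp_all add: f_bounds T_f)
  show "mul (J (P i e - f)) (J (P k e - f)) = J ?c"
    using P_eq_mul(1)[OF i] P_eq_mul(2)[OF k] i k p f_bounds
      order_projection_commute[OF P[OF i] P[OF k], of e]
    by (simp add: J_simps mul_simps Jq)
  have TPf: "J (T (P j f)) = mul (J f) (J f)" if "1 \<le> j" for j
    by (rule T_P_eq_mul[OF that]) (simp_all add: f_bounds T_f)
  have "J (T (P i (P k e))) = (if i = k then J f else mul (J f) (J f))"
  proof (cases "i = k")
    case True
    then show ?thesis using order_projection_idem[OF P] mean i by simp
  next
    case False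
    obtain G where "P k e \<in> G"
      "\<And>Q. order_projection Q \<Longrightarrow> Q e \<in> G \<Longrightarrow> T (P i (Q e)) = T (P i (T (Q e)))"
      using independent_of_the_others[OF indep e(2) i] False k by metis
    then show ?thesis
      using T_P_order_projection[OF i P[OF k]] P[OF k] mean[OF k] False by simp
  qed
  then show "J (T ?c) = (if i = k then mul (J f) (J (e - f)) else 0)"
    using TPf[OF i] TPf[OF k] by (simp add: T_simps J_simps Jq mul_simps mul_unit Tq)
qed

lemma T_sum: "T (\<Sum>j=1..n. P j e) = real n *\<^sub>R f"
  by (simp add: linear_sum[OF T_linear] mean scaleR_conv_of_real sum_constant_scaleR del: sum_constant)

lemma variance_sum:
  "J (variance J mul T (\<Sum>j=1..n. P j e)) = real n *\<^sub>R mul (J f) (J (e - f))"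
proof -
  let ?I = "{1..n}" and ?v = "mul (J f) (J (e - f))"
  have "\<forall>i k. \<exists>c. i \<in> ?I \<and> k \<in> ?I \<longrightarrow>
      mul (J (P i e - f)) (J (P k e - f)) = J c \<and> J (T c) = (if i = k then ?v else 0)"
    using T_centered_product by (metis atLeastAtMost_iff)
  then obtain c where c: "\<And>i k. i \<in> ?I \<Longrightarrow> k \<in> ?I \<Longrightarrow>
      mul (J (P i e - f)) (J (P k e - f)) = J (c i k) \<and> J (T (c i k)) = (if i = k then ?v else 0)"
    by metis
  have "(\<Sum>j=1..n. P j e) - T (\<Sum>j=1..n. P j e) = (\<Sum>i\<in>?I. P i e - f)"
    unfolding T_sum by (simp add: sum_subtractf sum_constant_scaleR del: sum_constant)
  then have "variance J mul T (\<Sum>j=1..n. P j e) =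
      T (inv J (mul (\<Sum>i\<in>?I. J (P i e - f)) (\<Sum>k\<in>?I. J (P k e - f))))"
    by (simp only: variance_def linear_sum[OF J_linear])
  also have "mul (\<Sum>i\<in>?I. J (P i e - f)) (\<Sum>k\<in>?I. J (P k e - f)) =
      (\<Sum>i\<in>?I. \<Sum>k\<in>?I. mul (J (P i e - f)) (J (P k e - f)))"
    unfolding linear_sum[OF mul_linear_left] unfolding linear_sum[OF mul_linear_right] ..
  also have "\<dots> = J (\<Sum>i\<in>?I. \<Sum>k\<in>?I. c i k)"
    using c by (simp add: linear_sum[OF J_linear])
  finally have "J (variance J mul T (\<Sum>j=1..n. P j e)) = (\<Sum>i\<in>?I. \<Sum>k\<in>?I. J (T (c i k)))"
    by (simp only: inv_f_f[OF J_inj]) (simp only: linear_sum[OF J_linear] linear_sum[OF T_linear])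
  also have "\<dots> = (\<Sum>i\<in>?I. \<Sum>k\<in>?I. if i = k then ?v else 0)"
    using c by (intro sum.cong refl) auto
  also have "\<dots> = real n *\<^sub>R ?v"
    by (simp add: sum_constant_scaleR del: sum_constant)
  finally show ?thesis .
qed

text \<open>
  The square expands into products of two indicators, and these are indicators again.
\<close>
lemma sum_in_L2: "(\<Sum>j=1..n. P j e) \<in> L2 J mul"
proof -
  let ?S = "\<Sum>j=1..n. P j e"
  have "mul (J ?S) (J ?S) = (\<Sum>i\<in>{1..n}. \<Sum>k\<in>{1..n}. mul (J (P i e)) (J (P k e)))"
    unfolding linear_sum[OF J_linear] linear_sum[OF mul_linear_left]
    unfolding linear_sum[OF mul_linear_right] ..
  also have "\<dots> = (\<Sum>i\<in>{1..n}. \<Sum>k\<in>{1..n}. J (P i (P k e)))"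
    by (intro sum.cong refl P_eq_mul order_projection_nonneg[OF P] order_projection_le[OF P]
        e_nonneg) auto
  also have "\<dots> = J (\<Sum>i\<in>{1..n}. \<Sum>k\<in>{1..n}. P i (P k e))"
    by (simp only: linear_sum[OF J_linear])
  finally show ?thesis by (simp add: L2_def)
qed

end

theorem theorem5p2:
  fixes T :: "'a::dedekind_complete_riesz_space \<Rightarrow> 'a"
    and J :: "'a \<Rightarrow> 'u::dedekind_complete_riesz_space"
    and mul :: "'u \<Rightarrow> 'u \<Rightarrow> 'u"
    and e f :: 'a
    and P :: "nat \<Rightarrow> 'a \<Rightarrow> 'a"
    and S :: "nat \<Rightarrow> 'a"
  assumes "cond_expectation T"
    and "strictly_positive T"
    and "universal_completion J"
    and "T_universally_complete J T"
    and "weak_order_unit e"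
    and "e = T e"
    and "natural_f_algebra_mult (J e) mul"
    and "indep_projection_seq T e P"
    and "\<And>j. j \<ge> 1 \<Longrightarrow> T (P j e) = f"
    and "\<And>n. S n = (\<Sum>j=1..n. P j e)"
  shows "\<forall>n. \<forall>j\<in>{0..n}.
      T (S n) = real n *\<^sub>R f \<and>
      J (T (proj_eq (S n) (real j *\<^sub>R e) e)) =
        (fact n / (fact j * fact (n - j))) *\<^sub>R
          mul (mult_power (J e) mul (J f) j) (mult_power (J e) mul (J (e - f)) (n - j)) \<and>
      S n \<in> L2 J mul \<and>
      J (variance J mul T (S n)) = real n *\<^sub>R mul (J f) (J (e - f))"
proof -
  interpret bernoulli_projections T J mul e f P
    using assms by unfold_locales simp_all
  have "J (T (proj_eq (S n) (real j *\<^sub>R e) e)) =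
      (fact n / (fact j * fact (n - j))) *\<^sub>R
        mul (mult_power (J e) mul (J f) j) (mult_power (J e) mul (J (e - f)) (n - j))"
    if "j \<in> {0..n}" for n j
  proof -
    have "proj_eq (S n) (real j *\<^sub>R e) e = count_event P n {j} e"
      unfolding assms(10) by (rule proj_eq_sum_eq_count_event[OF P e(1)])
    moreover have "real (n choose j) = fact n / (fact j * fact (n - j))"
      using that by (intro binomial_fact) simp
    moreover have "mul (mult_power (J e) mul (J f) j) (mult_power (J e) mul (J (e - f)) (n - j)) =
        (mul (J f) ^^ j) ((mul (J (e - f)) ^^ (n - j)) (J e))"
      by (subst funpow_mult_distrib[OF mul_f_algebra mul_unit(1)]) (simp only: mult_power_def)
    ultimately show ?thesis by (simp only: T_count_event)
  qed
  then show ?thesis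
    using T_sum sum_in_L2 variance_sum by (auto simp only: assms(10))
qed

end
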